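(* If $(X,Y)\in\mathcal{W}_n$ then $$\mathrm{Tr}([X,Y]^{2k-1})=0,\quad \mathrm{Tr}([X,Y]^{4k-2})\le 0,\quad \mathrm{Tr}([X,Y]^{4k})\ge 0$$ are valid for all integers $k\ge1$.
   Context: $\mathbb{H}$ is the division ring of real quaternions and $M_n(\mathbb{H})$ the algebra of $n\times n$ quaternionic matrices. $\mathcal{W}_n$ is the set of all pairs $(A,B)\in M_n(\mathbb{H})\times M_n(\mathbb{H})$ that are simultaneously triangularizable, i.e. for which there is $P\in\mathrm{GL}_n(\mathbb{H})$ such that $PAP^{-1}$ and $PBP^{-1}$ are both upper triangular. The quaternionic trace of $A=[a_{ij}]\in M_n(\mathbb{H})$ is $\mathrm{Tr}(A)=\sum_{i=1}^n(a_{ii}+\overline{a_{ii}})=2\,\mathrm{Re}\left(\sum_i a_{ii}\right)\in\mathbb{R}$. $[X,Y]=XY-YX$. *)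

theory Defs
  imports Complex_Main "Jordan_Normal_Form.Matrix"
begin

datatype quat = Quat (qre: real) (qi: real) (qj: real) (qk: real)

lemma quat_eq_iff: "x = y \<longleftrightarrow> qre x = qre y \<and> qi x = qi y \<and> qj x = qj y \<and> qk x = qk y"
  by (cases x; cases y) simp

instantiation quat :: division_ring
begin

definition zero_quat :: quat where "0 = Quat 0 0 0 0"
definition one_quat :: quat where "1 = Quat 1 0 0 0"
definition plus_quat :: "quat \<Rightarrow> quat \<Rightarrow> quat" where
  "x + y = Quat (qre x + qre y) (qi x + qi y) (qj x + qj y) (qk x + qk y)"
definition uminus_quat :: "quat \<Rightarrow> quat" where
  "- x = Quat (- qre x) (- qi x) (- qj x) (- qk x)"
definition minus_quat :: "quat \<Rightarrow> quat \<Rightarrow> quat" where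
  "x - y = Quat (qre x - qre y) (qi x - qi y) (qj x - qj y) (qk x - qk y)"
definition times_quat :: "quat \<Rightarrow> quat \<Rightarrow> quat" where
  "x * y = Quat
    (qre x * qre y - qi x * qi y - qj x * qj y - qk x * qk y)
    (qre x * qi y + qi x * qre y + qj x * qk y - qk x * qj y)
    (qre x * qj y - qi x * qk y + qj x * qre y + qk x * qi y)
    (qre x * qk y + qi x * qj y - qj x * qi y + qk x * qre y)"
definition inverse_quat :: "quat \<Rightarrow> quat" where
  "inverse x = (let N = (qre x)\<^sup>2 + (qi x)\<^sup>2 + (qj x)\<^sup>2 + (qk x)\<^sup>2
     in Quat (qre x / N) (- qi x / N) (- qj x / N) (- qk x / N))"
definition divide_quat where
  "x div y = x * inverse y" for x y :: quat

lemmas quat_ring_defs =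
  zero_quat_def one_quat_def plus_quat_def uminus_quat_def minus_quat_def times_quat_def

lemma quat_norm_sq_pos:
  assumes "x \<noteq> 0"
  shows "(qre x)\<^sup>2 + (qi x)\<^sup>2 + (qj x)\<^sup>2 + (qk x)\<^sup>2 > 0"
proof -
  from assms have "qre x \<noteq> 0 \<or> qi x \<noteq> 0 \<or> qj x \<noteq> 0 \<or> qk x \<noteq> 0"
    by (auto simp: quat_eq_iff zero_quat_def)
  then show ?thesis
    by (auto simp: add_nonneg_pos add_pos_nonneg)
qed

instance
proof
  fix x y z :: quat
  show "x * y * z = x * (y * z)" "(x + y) * z = x * z + y * z" "x * (y + z) = x * y + x * z"
    by (simp_all add: quat_ring_defs algebra_simps)
  show "inverse x * x = 1" "x * inverse x = 1" if "x \<noteq> 0"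
    using quat_norm_sq_pos[OF that]
    by (simp_all add: inverse_quat_def Let_def times_quat_def one_quat_def
        add_divide_distrib[symmetric] power2_eq_square algebra_simps)
qed (simp_all add: quat_ring_defs inverse_quat_def divide_quat_def Let_def quat_eq_iff)

end

lemma quat_sel_simps [simp]:
  "qre 0 = 0" "qi 0 = 0" "qj 0 = 0" "qk 0 = 0"
  "qre (x + y) = qre x + qre y" "qi (x + y) = qi x + qi y"
  "qj (x + y) = qj x + qj y" "qk (x + y) = qk x + qk y"
  by (simp_all add: quat_ring_defs)

lemma quat_units_mult:
  "Quat 0 1 0 0 * Quat 0 1 0 0 = - 1" "Quat 0 0 1 0 * Quat 0 0 1 0 = - 1"
  "Quat 0 0 0 1 * Quat 0 0 0 1 = - 1" "Quat 0 1 0 0 * Quat 0 0 1 0 = Quat 0 0 0 1"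
  "Quat 0 0 1 0 * Quat 0 1 0 0 = - Quat 0 0 0 1"
  by (simp_all add: quat_ring_defs)

definition quat_of_real :: "real \<Rightarrow> quat" where
  "quat_of_real r = Quat r 0 0 0"

definition qcnj :: "quat \<Rightarrow> quat" where
  "qcnj x = Quat (qre x) (- qi x) (- qj x) (- qk x)"

definition quat_trace :: "quat mat \<Rightarrow> real" where
  "quat_trace A = 2 * qre (\<Sum>i<dim_row A. A $$ (i, i))"

lemma quat_of_real_quat_trace:
  "quat_of_real (quat_trace A) = (\<Sum>i<dim_row A. A $$ (i, i) + qcnj (A $$ (i, i)))"
proof -
  have "qre (sum f S) = (\<Sum>i\<in>S. qre (f i))" "qi (sum f S) = (\<Sum>i\<in>S. qi (f i))"
    "qj (sum f S) = (\<Sum>i\<in>S. qj (f i))" "qk (sum f S) = (\<Sum>i\<in>S. qk (f i))"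
    for f :: "nat \<Rightarrow> quat" and S
    by (induction S rule: infinite_finite_induct; simp)+
  then show ?thesis
    by (simp add: quat_eq_iff quat_of_real_def quat_trace_def qcnj_def sum_distrib_left)
qed

text \<open>\<^term>\<open>Q\<close> plays the role of the inverse of \<^term>\<open>P\<close>.\<close>

definition simul_triangularizable :: "nat \<Rightarrow> (quat mat \<times> quat mat) set" where
  "simul_triangularizable n = {(A, B). A \<in> carrier_mat n n \<and> B \<in> carrier_mat n n \<and>
     (\<exists>P \<in> carrier_mat n n. \<exists>Q \<in> carrier_mat n n. P * Q = 1\<^sub>m n \<and> Q * P = 1\<^sub>m n \<and>
        upper_triangular (P * A * Q) \<and> upper_triangular (P * B * Q))}"

definition mat_commutator :: "'a :: ring mat \<Rightarrow> 'a mat \<Rightarrow> 'a mat" where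
  "mat_commutator X Y = X * Y - Y * X"

end

theory Submission
  imports Defs
begin

text \<open>The quaternionic trace is a class function, so \<open>[X, Y]\<close> may be replaced by the commutator of two
  upper triangular matrices. The diagonal entries of its powers are the powers of commutators
  \<open>c = [a, b]\<close> of quaternions. Such a \<open>c\<close> is purely imaginary, hence \<open>c\<^sup>2\<close> is a nonpositive real number,
  which gives the three sign conditions entry by entry.\<close>

lemma qre_sum: "qre (\<Sum>x\<in>S. f x) = (\<Sum>x\<in>S. qre (f x))"
  by (induction S rule: infinite_finite_induct) simp_all

text \<open>The noncommutative terms of a quaternion product are cross products of imaginary parts
  and lie in the imaginary components; the real part is a symmetric bilinear form.\<close>

lemma qre_mult_commute: "qre (x * y) = qre (y * x)"
  by (simp add: times_quat_def mult.commute)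

lemma qre_commutator: "qre (x * y - y * x) = 0"
  by (simp add: minus_quat_def qre_mult_commute[of x y])

lemma quat_of_real_mult: "quat_of_real a * quat_of_real b = quat_of_real (a * b)"
  by (simp add: times_quat_def quat_of_real_def)

lemma imaginary_power_even:
  assumes "qre c = 0"
  shows "c ^ (2 * m) = quat_of_real ((- ((qi c)\<^sup>2 + (qj c)\<^sup>2 + (qk c)\<^sup>2)) ^ m)"
proof (induction m)
  case 0
  show ?case by (simp add: quat_of_real_def one_quat_def)
next
  case (Suc m)
  have "c * c = quat_of_real (- ((qi c)\<^sup>2 + (qj c)\<^sup>2 + (qk c)\<^sup>2))"
    using assms by (simp add: times_quat_def quat_of_real_def power2_eq_square)
  moreover have "c ^ (2 * Suc m) = c * c * c ^ (2 * m)"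
    by (simp add: mult.assoc)
  ultimately show ?case
    by (simp only: Suc.IH quat_of_real_mult power_Suc)
qed

text \<open>An odd power is \<open>c\<close> times an even power, hence a real multiple of
  \<open>c\<close>, and so imaginary again.\<close>

lemma qre_imaginary_power_odd:
  assumes "qre c = 0" "odd m"
  shows "qre (c ^ m) = 0"
proof -
  obtain l where "m = Suc (2 * l)"
    using assms(2) by (auto elim: oddE)
  then show ?thesis
    using assms(1)
    by (simp add: imaginary_power_even[OF assms(1)] times_quat_def quat_of_real_def)
qed

lemma qre_imaginary_power_nonneg:
  assumes "qre c = 0" "even m"
  shows "qre (c ^ (2 * m)) \<ge> 0"
  using assms by (simp only: imaginary_power_even quat_of_real_def quat.sel zero_le_even_power)

lemma qre_imaginary_power_nonpos:
  assumes "qre c = 0" "odd m"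
  shows "qre (c ^ (2 * m)) \<le> 0"
  using assms
  \<comment> \<open>The base stays the negative of a sum of squares, so its sign is visible to
    \<open>power_le_zero_eq\<close>.\<close>
  by (simp add: imaginary_power_even quat_of_real_def power_le_zero_eq odd_pos del: minus_add_distrib)

lemma upper_triangular_mult:
  fixes A B :: "'a :: semiring_0 mat"
  assumes A: "A \<in> carrier_mat n n" "upper_triangular A"
    and B: "B \<in> carrier_mat n n" "upper_triangular B"
  shows "upper_triangular (A * B)"
    and "i < n \<Longrightarrow> (A * B) $$ (i, i) = A $$ (i, i) * B $$ (i, i)"
proof -
  have entry: "(A * B) $$ (i, j) = (\<Sum>l<n. A $$ (i, l) * B $$ (l, j))" if "i < n" "j < n" for i j
    using that A(1) B(1) by (simp add: scalar_prod_def atLeast0LessThan)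
  \<comment> \<open>If l < i the factor from \<open>A\<close> lies below the diagonal, if j < l the
    one from \<open>B\<close>. For j < i every l falls under one of the cases; for j = i only l = i
    survives.\<close>
  have zero: "A $$ (i, l) * B $$ (l, j) = 0" if "i < n" "l < n" "l < i \<or> j < l" for i j l
    using that upper_triangularD[OF A(2), of l i] upper_triangularD[OF B(2), of j l] A(1) B(1) by auto
  show "upper_triangular (A * B)"
  proof (rule upper_triangularI)
    fix i j assume "j < i" "i < dim_row (A * B)"
    then show "(A * B) $$ (i, j) = 0"
      using A(1) by (subst entry) (auto intro!: sum.neutral zero)
  qed
  assume "i < n"
  then have "(\<Sum>l<n. A $$ (i, l) * B $$ (l, i)) = (\<Sum>l<n. if l = i then A $$ (i, i) * B $$ (i, i) else 0)"
    by (intro sum.cong) (auto intro!: zero simp: nat_neq_iff)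
  with \<open>i < n\<close> show "(A * B) $$ (i, i) = A $$ (i, i) * B $$ (i, i)"
    by (simp add: entry)
qed

lemma upper_triangular_pow:
  fixes A :: "'a :: semiring_1 mat"
  assumes "A \<in> carrier_mat n n" "upper_triangular A"
  shows "upper_triangular (A ^\<^sub>m m)"
    and "i < n \<Longrightarrow> (A ^\<^sub>m m) $$ (i, i) = (A $$ (i, i)) ^ m"
proof (induction m)
  case 0
  { case 1 show ?case by simp }
  { case 2 then show ?case using assms by simp }
next
  case (Suc m)
  have "A ^\<^sub>m m \<in> carrier_mat n n"
    using assms(1) by (rule pow_carrier_mat)
  note mult = upper_triangular_mult[OF this Suc(1) assms]
  { case 1 show ?case using mult(1) by simp }
  \<comment> \<open>The matrix power appends its new factor on the right, the quaternion-style power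
    \<open>^\<close> on the left; an element commutes with its own powers.\<close>
  { case 2 then show ?case using mult(2) Suc(2) by (simp add: power_commutes) }
qed

lemma mat_commutator_carrier:
  "X \<in> carrier_mat n n \<Longrightarrow> Y \<in> carrier_mat n n \<Longrightarrow> mat_commutator X Y \<in> carrier_mat n n"
  by (auto simp: mat_commutator_def)

text \<open>Over a noncommutative ring the diagonal need not vanish: its entries are commutators of
  scalars.\<close>

lemma upper_triangular_commutator:
  assumes X: "X \<in> carrier_mat n n" "upper_triangular X"
    and Y: "Y \<in> carrier_mat n n" "upper_triangular Y"
  shows "upper_triangular (mat_commutator X Y)"
    and "i < n \<Longrightarrow> mat_commutator X Y $$ (i, i) = X $$ (i, i) * Y $$ (i, i) - Y $$ (i, i) * X $$ (i, i)"
proof -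
  note XY = upper_triangular_mult[OF X Y] and YX = upper_triangular_mult[OF Y X]
  show "upper_triangular (mat_commutator X Y)"
  proof (rule upper_triangularI)
    fix i j assume "j < i" "i < dim_row (mat_commutator X Y)"
    then show "mat_commutator X Y $$ (i, j) = 0"
      using X(1) Y(1) upper_triangularD[OF XY(1), of j i] upper_triangularD[OF YX(1), of j i]
      by (simp add: mat_commutator_def del: index_mult_mat(1))
  qed
  show "i < n \<Longrightarrow> mat_commutator X Y $$ (i, i) = X $$ (i, i) * Y $$ (i, i) - Y $$ (i, i) * X $$ (i, i)"
    using X(1) Y(1) XY(2) YX(2) by (simp add: mat_commutator_def del: index_mult_mat(1))
qed

lemma conjugate_mat_mult:
  fixes A B :: "'a :: semiring_1 mat"
  assumes "A \<in> carrier_mat n n" "B \<in> carrier_mat n n" "P \<in> carrier_mat n n" "Q \<in> carrier_mat n n"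
    and "Q * P = 1\<^sub>m n"
  shows "(P * A * Q) * (P * B * Q) = P * (A * B) * Q"
proof -
  \<comment> \<open>Reassociation brings \<open>Q\<close> and \<open>P\<close> together, where they
    cancel.\<close>
  have "(P * A * Q) * (P * B * Q) = P * (A * ((Q * P) * (B * Q)))"
    using assms(1-4) by (simp add: assoc_mult_mat[of _ n n _ n _ n])
  also have "\<dots> = P * (A * B) * Q"
    using assms by (simp add: assoc_mult_mat[of _ n n _ n _ n])
  finally show ?thesis .
qed

lemma conjugate_mat_commutator:
  fixes X Y :: "'a :: ring_1 mat"
  assumes "X \<in> carrier_mat n n" "Y \<in> carrier_mat n n" "P \<in> carrier_mat n n" "Q \<in> carrier_mat n n"
    and "Q * P = 1\<^sub>m n"
  shows "mat_commutator (P * X * Q) (P * Y * Q) = P * mat_commutator X Y * Q"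
proof -
  have "P * mat_commutator X Y * Q = P * (X * Y) * Q - P * (Y * X) * Q"
    using assms(1-4) unfolding mat_commutator_def
    by (subst mult_minus_distrib_mat[of _ n n _ n]) (auto intro!: minus_mult_distrib_mat)
  then show ?thesis
    using assms by (simp only: mat_commutator_def conjugate_mat_mult[where n = n])
qed

text \<open>The sum of the diagonal entries is not cyclic over the quaternions, but its real part
  is, since \<open>qre\<close> allows the two factors of each summand to be exchanged.\<close>

lemma quat_trace_mult_commute:
  assumes A: "A \<in> carrier_mat n n" and B: "B \<in> carrier_mat n n"
  shows "quat_trace (A * B) = quat_trace (B * A)"
proof -
  have "qre (\<Sum>i<n. (A * B) $$ (i, i)) = (\<Sum>i<n. \<Sum>j<n. qre (A $$ (i, j) * B $$ (j, i)))"
    using A B by (simp add: qre_sum scalar_prod_def atLeast0LessThan)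
  also have "\<dots> = (\<Sum>j<n. \<Sum>i<n. qre (B $$ (j, i) * A $$ (i, j)))"
    by (subst sum.swap) (simp only: qre_mult_commute)
  also have "\<dots> = qre (\<Sum>j<n. (B * A) $$ (j, j))"
    using A B by (simp add: qre_sum scalar_prod_def atLeast0LessThan)
  finally show ?thesis
    using A B by (simp add: quat_trace_def)
qed

lemma quat_trace_conjugate:
  assumes "A \<in> carrier_mat n n" "P \<in> carrier_mat n n" "Q \<in> carrier_mat n n" "Q * P = 1\<^sub>m n"
  shows "quat_trace (P * A * Q) = quat_trace A"
proof -
  have "quat_trace (P * A * Q) = quat_trace (Q * (P * A))"
    using assms by (intro quat_trace_mult_commute) auto
  also have "Q * (P * A) = A"
    using assms by (simp flip: assoc_mult_mat[of Q n n P n A n])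
  finally show ?thesis .
qed

text \<open>One family \<open>c\<close> serves all exponents \<open>m\<close>, so the signs can
  afterwards be read off summand by summand.\<close>

lemma quat_trace_commutator_power:
  assumes "(X, Y) \<in> simul_triangularizable n"
  obtains c where "\<And>i. qre (c i) = 0"
    and "\<And>m. quat_trace (mat_commutator X Y ^\<^sub>m m) = 2 * (\<Sum>i<n. qre (c i ^ m))"
proof -
  from assms obtain P Q where
    X: "X \<in> carrier_mat n n" and Y: "Y \<in> carrier_mat n n" and
    P: "P \<in> carrier_mat n n" and Q: "Q \<in> carrier_mat n n" and
    PQ: "P * Q = 1\<^sub>m n" and QP: "Q * P = 1\<^sub>m n" and
    tri: "upper_triangular (P * X * Q)" "upper_triangular (P * Y * Q)"
    by (auto simp: simul_triangularizable_def)
  define S T where "S = P * X * Q" and "T = P * Y * Q"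
  \<comment> \<open>For i \<ge> n the entries are unspecified, but \<open>c i\<close> is still a
    commutator, so its real part is 0 for every \<open>i\<close>.\<close>
  define c where "c i = S $$ (i, i) * T $$ (i, i) - T $$ (i, i) * S $$ (i, i)" for i
  have ST: "S \<in> carrier_mat n n" "T \<in> carrier_mat n n"
    using X Y P Q by (auto simp: S_def T_def)
  note C = mat_commutator_carrier[OF X Y] and D = mat_commutator_carrier[OF ST]
  note D_tri = upper_triangular_commutator[OF ST(1) tri(1)[folded S_def] ST(2) tri(2)[folded T_def]]
  \<comment> \<open>Conjugation commutes with the commutator; phrased as similarity, this carries
    over to all powers.\<close>
  have "similar_mat_wit (mat_commutator S T) (mat_commutator X Y) P Q"
    using X Y P Q PQ QP C D
    by (intro similar_mat_witI[of _ _ n])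
      (simp_all only: S_def T_def conjugate_mat_commutator[OF X Y P Q QP])
  then have pow: "mat_commutator S T ^\<^sub>m m = P * mat_commutator X Y ^\<^sub>m m * Q" for m
    by (rule similar_mat_wit_pow_id)
  have "quat_trace (mat_commutator X Y ^\<^sub>m m) = quat_trace (mat_commutator S T ^\<^sub>m m)" for m
    unfolding pow using C P Q QP by (simp add: quat_trace_conjugate[of _ n])
  then have "quat_trace (mat_commutator X Y ^\<^sub>m m) = 2 * (\<Sum>i<n. qre (c i ^ m))" for m
    using D upper_triangular_pow(2)[OF D D_tri(1)]
    by (simp add: quat_trace_def qre_sum D_tri(2) c_def)
  moreover have "qre (c i) = 0" for i
    by (simp add: c_def qre_commutator)
  ultimately show thesis
    using that by blast
qed

theorem corollary6p3:
  fixes n k :: nat and X Y :: "quat mat"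
  assumes "(X, Y) \<in> simul_triangularizable n" and "k \<ge> 1"
  shows "quat_trace (mat_commutator X Y ^\<^sub>m (2 * k - 1)) = 0
    \<and> quat_trace (mat_commutator X Y ^\<^sub>m (4 * k - 2)) \<le> 0
    \<and> quat_trace (mat_commutator X Y ^\<^sub>m (4 * k)) \<ge> 0"
proof -
  obtain c where c: "\<And>i. qre (c i) = 0"
    and trace: "\<And>m. quat_trace (mat_commutator X Y ^\<^sub>m m) = 2 * (\<Sum>i<n. qre (c i ^ m))"
    using quat_trace_commutator_power[OF assms(1)] by blast
  \<comment> \<open>The last two exponents are twice the odd number \<open>m\<close> and twice the
    even number \<open>2 * k\<close>. As k \<ge> 1, the subtractions are not truncated.\<close>
  define m where "m = 2 * k - 1"
  have odd: "odd m" and exponents: "4 * k - 2 = 2 * m" "4 * k = 2 * (2 * k)"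
    using assms(2) by (simp_all add: m_def)
  show ?thesis
    \<comment> \<open>\<open>4 * k - 2\<close> is replaced first, before \<open>4 * k\<close> inside
      it could be rewritten.\<close>
    unfolding m_def[symmetric] exponents(1) unfolding exponents(2) trace
    using odd c
    by (intro conjI mult_nonneg_nonneg mult_nonneg_nonpos sum_nonneg sum_nonpos
        qre_imaginary_power_nonneg qre_imaginary_power_nonpos)
      (simp_all add: qre_imaginary_power_odd)
qed

end
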